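(* Let $G=(V,E)$ be a directed acyclic graph (DAG) with $V=[p]$, i.e. a directed graph containing all self-loops $i\to i$, $i\in[p]$, and no other directed cycles. Then the model $\mathcal{M}_{G,C}$ is globally identifiable for every matrix $C\in\mathrm{PD}_p$.
   Context: $[p]=\{1,\dots,p\}$, and $\mathrm{PD}_p$ is the cone of real symmetric positive definite $p\times p$ matrices. $\mathbb{R}^E$ is the space of real $p\times p$ matrices $M=(m_{ij})$ with $m_{ji}=0$ whenever $i\to j\notin E$; $\mathrm{Stab}(E)\subseteq\mathbb{R}^E$ is the subset of stable matrices (all eigenvalues have negative real part). For $C\in\mathrm{PD}_p$, the graphical continuous Lyapunov model is $\mathcal{M}_{G,C}=\{\Sigma\in\mathrm{PD}_p: M\Sigma+\Sigma M^\top=-C \text{ for some } M\in\mathbb{R}^E\}$. The map $\phi_{G,C}:\mathrm{Stab}(E)\to\mathrm{PD}_p$ sends $M$ to the unique $\Sigma$ solving $M\Sigma+\Sigma M^\top+C=0$. The fiber of $M_0\in\mathrm{Stab}(E)$ is $\mathcal{F}_{G,C}(M_0)=\{M\in\mathrm{Stab}(E):\phi_{G,C}(M)=\phi_{G,C}(M_0)\}$. The model $\mathcal{M}_{G,C}$ is globally identifiable if $\mathcal{F}_{G,C}(M_0)=\{M_0\}$ for all $M_0\in\mathrm{Stab}(E)$. *)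

theory Defs
  imports Complex_Main "Jordan_Normal_Form.Matrix" "Jordan_Normal_Form.Char_Poly"
begin

(* Matrices are indexed from 0, so the vertex set [p] = {1,...,p} is represented by {..<p}. *)

(* The self-loops are exactly the pairs in Id; a directed cycle other than a self-loop, or a closed
   walk containing one, survives in E - Id. *)
definition dag_with_self_loops :: "nat \<Rightarrow> (nat \<times> nat) set \<Rightarrow> bool" where
  "dag_with_self_loops p E \<longleftrightarrow>
     E \<subseteq> {..<p} \<times> {..<p} \<and> (\<forall>i<p. (i, i) \<in> E) \<and> acyclic (E - Id)"

definition PD :: "nat \<Rightarrow> real mat set" where
  "PD p = {A \<in> carrier_mat p p. transpose_mat A = A \<and>
     (\<forall>x \<in> carrier_vec p. x \<noteq> 0\<^sub>v p \<longrightarrow> x \<bullet> (A *\<^sub>v x) > 0)}"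

(* Note the transposition: the edge i \<rightarrow> j carries the entry in row j and column i. *)
definition edge_matrices :: "nat \<Rightarrow> (nat \<times> nat) set \<Rightarrow> real mat set" where
  "edge_matrices p E = {M \<in> carrier_mat p p.
     \<forall>i<p. \<forall>j<p. (i, j) \<notin> E \<longrightarrow> M $$ (j, i) = 0}"

definition stable_mat :: "real mat \<Rightarrow> bool" where
  "stable_mat M \<longleftrightarrow> (\<forall>z. eigenvalue (map_mat complex_of_real M) z \<longrightarrow> Re z < 0)"

definition Stab :: "nat \<Rightarrow> (nat \<times> nat) set \<Rightarrow> real mat set" where
  "Stab p E = {M \<in> edge_matrices p E. stable_mat M}"

(* Only meaningful for stable M and C in PD p, where the Lyapunov equation has exactly one solution
   and this solution is positive definite. *)
definition lyapunov_solution :: "nat \<Rightarrow> real mat \<Rightarrow> real mat \<Rightarrow> real mat" where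
  "lyapunov_solution p C M =
     (THE S. S \<in> PD p \<and> M * S + S * transpose_mat M + C = 0\<^sub>m p p)"

definition lyapunov_fiber ::
    "nat \<Rightarrow> (nat \<times> nat) set \<Rightarrow> real mat \<Rightarrow> real mat \<Rightarrow> real mat set" where
  "lyapunov_fiber p E C M0 =
     {M \<in> Stab p E. lyapunov_solution p C M = lyapunov_solution p C M0}"

(* Identifiability of the graphical continuous Lyapunov model is a property of its parametrization
   by Stab p E, not merely of the set of covariance matrices it contains. *)
definition globally_identifiable :: "nat \<Rightarrow> (nat \<times> nat) set \<Rightarrow> real mat \<Rightarrow> bool" where
  "globally_identifiable p E C \<longleftrightarrow> (\<forall>M0 \<in> Stab p E. lyapunov_fiber p E C M0 = {M0})"

end

theory Submission
  imports Defs
begin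

text \<open>
  Acyclicity makes every matrix in \<open>edge_matrices p E\<close> triangular with respect to a topological
  ranking. Hence stability means that the diagonal is negative, and the Lyapunov equation can be
  solved entry by entry along the ranking, with a unique solution. The solution is positive definite
  by induction on the number of vertices: if \<open>v\<close> is a sink and \<open>x\<close> with \<open>x\<^sub>v = 1\<close> is chosen such that
  \<open>\<Sigma> x\<close> is \<open>\<tau>\<close> times the unit vector of \<open>v\<close>, then evaluating the equation on \<open>x\<close> gives
  \<open>2 \<tau> M\<^sub>v\<^sub>v = - x \<bullet> C x < 0\<close>, so that the Schur complement \<open>\<tau>\<close> is positive.

  If \<open>M\<close> and \<open>M\<^sub>0\<close> have the same solution \<open>\<Sigma>\<close>, then \<open>N = M - M\<^sub>0\<close> satisfies \<open>N \<Sigma> + \<Sigma> N\<^sup>T = 0\<close>.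
  Suppose that the rows of \<open>N\<close> at the parents of \<open>i\<close> vanish. Then so do these rows of the
  skew-symmetric matrix \<open>N \<Sigma>\<close>, hence also its entries in row \<open>i\<close> at \<open>i\<close> and its parents. As row
  \<open>i\<close> of \<open>N\<close> is supported there, its quadratic form under \<open>\<Sigma>\<close> is zero, so it vanishes.
\<close>

section \<open>Triangularity along a ranking and the skew-symmetric product\<close>

definition pos_def_on :: "'a set \<Rightarrow> ('a \<Rightarrow> 'a \<Rightarrow> real) \<Rightarrow> bool" where
  "pos_def_on V S \<longleftrightarrow>
     (\<forall>x. (\<exists>i\<in>V. x i \<noteq> 0) \<longrightarrow> 0 < (\<Sum>i\<in>V. x i * (\<Sum>j\<in>V. S i j * x j)))"

definition lyapunov_on ::
    "'a set \<Rightarrow> ('a \<Rightarrow> 'a \<Rightarrow> real) \<Rightarrow> ('a \<Rightarrow> 'a \<Rightarrow> real) \<Rightarrow> ('a \<Rightarrow> 'a \<Rightarrow> real) \<Rightarrow> bool" where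
  "lyapunov_on V M S C \<longleftrightarrow>
     (\<forall>i\<in>V. \<forall>j\<in>V. (\<Sum>k\<in>V. M i k * S k j) + (\<Sum>k\<in>V. S i k * M j k) + C i j = 0)"

text \<open>\<open>f\<close> is a topological ranking: a nonzero off-diagonal \<open>M i j\<close>
  stands for an edge from \<open>j\<close> to \<open>i\<close>. Distinct vertices may share a rank.
  The diagonal is left free, so that the locale also covers differences of stable matrices.\<close>

locale acyclic_matrix =
  fixes V :: "'a set" and f :: "'a \<Rightarrow> nat" and M :: "'a \<Rightarrow> 'a \<Rightarrow> real"
  assumes finite_V: "finite V"
    and rank_less: "\<lbrakk>i \<in> V; j \<in> V; i \<noteq> j; M i j \<noteq> 0\<rbrakk> \<Longrightarrow> f j < f i"
begin

lemma sum_row_split: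
  assumes "i \<in> V"
  shows "(\<Sum>k\<in>V. M i k * g k) = M i i * g i + (\<Sum>k | k \<in> V \<and> f k < f i. M i k * g k)"
proof -
  have "(\<Sum>k\<in>V. M i k * g k) = M i i * g i + (\<Sum>k\<in>V - {i}. M i k * g k)"
    using assms finite_V by (simp add: sum.remove)
  also have "(\<Sum>k\<in>V - {i}. M i k * g k) = (\<Sum>k | k \<in> V \<and> f k < f i. M i k * g k)"
    using finite_V assms rank_less by (intro sum.mono_neutral_right) auto
  finally show ?thesis .
qed

text \<open>Intended for the difference of two stable matrices, whose diagonal has no definite sign;
  positive definiteness of \<open>S\<close> takes the place of a sign condition.\<close>

lemma skew_product_imp_zero:
  assumes S: "pos_def_on V S" and sym: "\<And>i j. \<lbrakk>i \<in> V; j \<in> V\<rbrakk> \<Longrightarrow> S i j = S j i"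
    and lyap: "lyapunov_on V M S (\<lambda>_ _. 0)"
    and "i \<in> V" "j \<in> V"
  shows "M i j = 0"
  using \<open>i \<in> V\<close> \<open>j \<in> V\<close>
proof (induction "f i" arbitrary: i j rule: less_induct)
  case less
  have skew: "(\<Sum>k\<in>V. M i k * S k a) = - (\<Sum>k\<in>V. M a k * S k i)" if "a \<in> V" for a
  proof -
    have "(\<Sum>k\<in>V. S i k * M a k) = (\<Sum>k\<in>V. M a k * S k i)"
      using sym less.prems(1) by (intro sum.cong) (auto simp: mult.commute)
    then show ?thesis
      using lyap less.prems(1) that unfolding lyapunov_on_def by fastforce
  qed
  \<comment> \<open>These are the terms of the quadratic form of row \<open>i\<close>. Where
    \<open>M i a\<close> is nonzero, either \<open>a = i\<close> and skewness makes the diagonal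
    entry of the product zero, or \<open>a\<close> has smaller rank and its row vanishes by
    induction.\<close>
  have zero: "M i a * (\<Sum>k\<in>V. S a k * M i k) = 0" if a: "a \<in> V" for a
  proof (cases "M i a = 0")
    case False
    have eq: "(\<Sum>k\<in>V. S a k * M i k) = (\<Sum>k\<in>V. M i k * S k a)"
      using sym a by (intro sum.cong) (auto simp: mult.commute)
    have "(\<Sum>k\<in>V. M i k * S k a) = 0"
    proof (cases "a = i")
      case True
      then show ?thesis using skew[OF a] by simp
    next
      case False
      then have "f a < f i" using rank_less less.prems(1) a \<open>M i a \<noteq> 0\<close> by auto
      then have "\<And>k. k \<in> V \<Longrightarrow> M a k = 0" using less.hyps a by blast
      then show ?thesis using skew[OF a] by simp
    qed
    then show ?thesis using eq by simp
  qed simp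
  have "(\<Sum>a\<in>V. M i a * (\<Sum>k\<in>V. S a k * M i k)) = 0"
    using zero by (simp add: sum.neutral)
  then have "\<not> (\<exists>a\<in>V. M i a \<noteq> 0)"
    using S[unfolded pos_def_on_def, rule_format, of "M i"] by auto
  then show ?case using less.prems(2) by blast
qed

section \<open>Unique solvability of the Lyapunov equation and positive definiteness of the
  solution\<close>

lemma lyapunov_homogeneous_zero:
  assumes neg: "\<And>i. i \<in> V \<Longrightarrow> M i i < 0"
    and lyap: "lyapunov_on V M D (\<lambda>_ _. 0)" and "i \<in> V" "j \<in> V"
  shows "D i j = 0"
  using \<open>i \<in> V\<close> \<open>j \<in> V\<close>
proof (induction "f i + f j" arbitrary: i j rule: less_induct)
  case less
  \<comment> \<open>In entry \<open>(i, j)\<close> of the equation, every term other than the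
    diagonal ones contains an entry of \<open>D\<close> with smaller rank sum, which is zero by
    induction.\<close>
  have "(\<Sum>k\<in>V. M i k * D k j) = M i i * D i j"
    unfolding sum_row_split[OF less.prems(1)]
    using less.hyps less.prems by (auto intro!: sum.neutral)
  moreover have "(\<Sum>k\<in>V. D i k * M j k) = M j j * D i j"
    unfolding mult.commute[of "D i _"] sum_row_split[OF less.prems(2)]
    using less.hyps less.prems by (auto intro!: sum.neutral)
  ultimately have "(M i i + M j j) * D i j = 0"
    using lyap[unfolded lyapunov_on_def, rule_format, OF less.prems] by (simp add: distrib_right)
  then show ?case using neg[OF less.prems(1)] neg[OF less.prems(2)] by auto
qed

text \<open>Forward substitution: entry \<open>(i, j)\<close> of the equation solved for the unknown
  at \<open>(i, j)\<close>, whose coefficient is \<open>M i i + M j j\<close>. All other unknowns in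
  it have a smaller rank sum.\<close>

function triangular_solution :: "('a \<Rightarrow> 'a \<Rightarrow> real) \<Rightarrow> 'a \<Rightarrow> 'a \<Rightarrow> real" where
  "triangular_solution C i j =
     - (C i j + (\<Sum>k | k \<in> V \<and> f k < f i. M i k * triangular_solution C k j)
              + (\<Sum>k | k \<in> V \<and> f k < f j. M j k * triangular_solution C i k)) / (M i i + M j j)"
  by pat_completeness auto
termination
  by (relation "measure (\<lambda>(_, i, j). f i + f j)") auto

declare triangular_solution.simps [simp del]

lemma lyapunov_triangular_solution:
  assumes neg: "\<And>i. i \<in> V \<Longrightarrow> M i i < 0"
  shows "lyapunov_on V M (triangular_solution C) C"
  unfolding lyapunov_on_def
proof (intro ballI)
  fix i j assume ij: "i \<in> V" "j \<in> V"
  let ?S = "triangular_solution C"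
  have "M i i + M j j \<noteq> 0" using neg[OF ij(1)] neg[OF ij(2)] by simp
  then have "(M i i + M j j) * ?S i j =
     - (C i j + (\<Sum>k | k \<in> V \<and> f k < f i. M i k * ?S k j)
              + (\<Sum>k | k \<in> V \<and> f k < f j. M j k * ?S i k))"
    by (subst triangular_solution.simps) simp
  then show "(\<Sum>k\<in>V. M i k * ?S k j) + (\<Sum>k\<in>V. ?S i k * M j k) + C i j = 0"
    unfolding mult.commute[of "?S i _"] sum_row_split[OF ij(1)] sum_row_split[OF ij(2)]
    by (simp add: algebra_simps)
qed

text \<open>Swapping the indices exchanges the two sums of the recursion.\<close>

lemma triangular_solution_symmetric:
  assumes C: "\<And>i j. \<lbrakk>i \<in> V; j \<in> V\<rbrakk> \<Longrightarrow> C i j = C j i" and "i \<in> V" "j \<in> V"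
  shows "triangular_solution C i j = triangular_solution C j i"
  using \<open>i \<in> V\<close> \<open>j \<in> V\<close>
proof (induction "f i + f j" arbitrary: i j rule: less_induct)
  case less
  have "(\<Sum>k | k \<in> V \<and> f k < f i. M i k * triangular_solution C k j) =
        (\<Sum>k | k \<in> V \<and> f k < f i. M i k * triangular_solution C j k)"
    using less by (intro sum.cong) auto
  moreover have "(\<Sum>k | k \<in> V \<and> f k < f j. M j k * triangular_solution C i k) =
        (\<Sum>k | k \<in> V \<and> f k < f j. M j k * triangular_solution C k i)"
    using less by (intro sum.cong) auto
  ultimately show ?case
    using C[OF less.prems]
    by (simp add: triangular_solution.simps[of C i j] triangular_solution.simps[of C j i] add_ac)
qed

text \<open>The vertex set \<open>U\<close> grows by one sink at a time. Solvability of linear systems is carried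
  through the same induction, since it supplies the vector \<open>x\<close> of the next step.\<close>

lemma lyapunov_solution_pos_def_aux:
  assumes neg: "\<And>i. i \<in> V \<Longrightarrow> M i i < 0"
    and C: "pos_def_on V C"
    and sym: "\<And>i j. \<lbrakk>i \<in> V; j \<in> V\<rbrakk> \<Longrightarrow> S i j = S j i"
    and lyap: "lyapunov_on V M S C"
    and "U \<subseteq> V" and "\<And>i j. \<lbrakk>i \<in> U; j \<in> V - U\<rbrakk> \<Longrightarrow> M i j = 0"
  shows "(\<forall>s. \<exists>y. (\<forall>i. i \<notin> U \<longrightarrow> y i = 0) \<and> (\<forall>i\<in>U. (\<Sum>j\<in>V. S i j * y j) = s i)) \<and>
    (\<forall>y. (\<forall>i. i \<notin> U \<longrightarrow> y i = 0) \<longrightarrow> (\<exists>i. y i \<noteq> 0) \<longrightarrow>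
       0 < (\<Sum>i\<in>V. y i * (\<Sum>j\<in>V. S i j * y j)))"
  using assms(5,6)
proof (induction "card U" arbitrary: U)
  case 0
  then have "U = {}" using finite_subset[OF _ finite_V] by auto
  then show ?case by auto
next
  case (Suc n)
  have finU: "finite U" using Suc.prems(1) finite_V finite_subset by auto
  have "U \<noteq> {}" using Suc.hyps(2) by auto
  \<comment> \<open>A vertex of maximal rank in \<open>U\<close> is a sink of \<open>U\<close>;
    hence \<open>U - {v}\<close> is again closed under parents and the induction hypothesis applies
    to it.\<close>
  then obtain v where v: "v \<in> U" and maxv: "\<And>i. i \<in> U \<Longrightarrow> f i \<le> f v"
  proof -
    have "Max (f ` U) \<in> f ` U" using finU \<open>U \<noteq> {}\<close> by (intro Max_in) auto
    then obtain v where "v \<in> U" "f v = Max (f ` U)" by auto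
    then show thesis using that finU by simp
  qed
  have vV: "v \<in> V" using v Suc.prems(1) by auto
  define W where "W = U - {v}"
  have sink: "M i v = 0" if "i \<in> W" for i
    using rank_less[of i v] maxv[of i] that vV Suc.prems(1) unfolding W_def by fastforce
  have "n = card W" using Suc.hyps(2) v finU unfolding W_def by simp
  moreover have "W \<subseteq> V" using Suc.prems(1) unfolding W_def by auto
  moreover have "M i j = 0" if "i \<in> W" "j \<in> V - W" for i j
    using that sink Suc.prems(2) unfolding W_def by (cases "j = v") auto
  ultimately have IH: "\<And>s. \<exists>y. (\<forall>i. i \<notin> W \<longrightarrow> y i = 0) \<and> (\<forall>i\<in>W. (\<Sum>j\<in>V. S i j * y j) = s i)"
    and posW: "\<And>y. \<lbrakk>\<forall>i. i \<notin> W \<longrightarrow> y i = 0; \<exists>i. y i \<noteq> 0\<rbrakk> \<Longrightarrow>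
       0 < (\<Sum>i\<in>V. y i * (\<Sum>j\<in>V. S i j * y j))"
    using Suc.hyps(1)[of W] by blast+
  define A where "A y i = (\<Sum>j\<in>V. S i j * y j)" for y i
  have A_add: "A (\<lambda>j. y j + c * z j) i = A y i + c * A z i" for y z c i
    unfolding A_def by (simp add: sum.distrib sum_distrib_left algebra_simps)
  have A_self_adjoint: "(\<Sum>i\<in>V. y i * A z i) = (\<Sum>i\<in>V. z i * A y i)" for y z
  proof -
    have "(\<Sum>i\<in>V. y i * A z i) = (\<Sum>i\<in>V. \<Sum>j\<in>V. z j * (S j i * y i))"
      unfolding A_def sum_distrib_left using sym by (intro sum.cong) (auto simp: mult_ac)
    also have "\<dots> = (\<Sum>j\<in>V. z j * A y j)"
      unfolding A_def sum_distrib_left by (rule sum.swap)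
    finally show ?thesis .
  qed
  \<comment> \<open>\<open>w\<close> corrects the unit vector \<open>e\<close> at \<open>v\<close>
    so that \<open>A\<close> applied to the sum vanishes on \<open>W\<close>.\<close>
  obtain w where w: "\<And>i. i \<notin> W \<Longrightarrow> w i = 0" "\<And>i. i \<in> W \<Longrightarrow> A w i = - S i v"
    using IH[of "\<lambda>i. - S i v"] unfolding A_def by blast
  define e where "e j = (if j = v then 1 else 0 :: real)" for j
  \<comment> \<open>The factor \<open>1\<close> gives \<open>x\<close> the shape required by
    \<open>A_add\<close>.\<close>
  define x where "x j = w j + 1 * e j" for j
  have Ae: "A e i = S i v" for i
  proof -
    have "A e i = (\<Sum>j\<in>{v}. S i j * e j)"
      unfolding A_def e_def using finite_V vV by (intro sum.mono_neutral_right) auto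
    then show ?thesis by (simp add: e_def)
  qed
  have xv: "x v = 1" using w(1)[of v] unfolding x_def e_def W_def by simp
  have xU: "x i = 0" if "i \<notin> U" for i
    using that w(1)[of i] v unfolding x_def e_def W_def by auto
  have Ax: "A x i = 0" if "i \<in> W" for i
    using A_add[of w 1 e i] w(2)[OF that] Ae[of i] unfolding x_def by simp
  \<comment> \<open>The Schur complement of the block \<open>W\<close> in the block \<open>U\<close>
    of \<open>S\<close>.\<close>
  define \<tau> where "\<tau> = A x v"
  have xA: "(\<Sum>i\<in>V. y i * A x i) = y v * \<tau>" if "\<And>i. i \<notin> U \<Longrightarrow> y i = 0" for y
  proof -
    have "(\<Sum>i\<in>V. y i * A x i) = (\<Sum>i\<in>{v}. y i * A x i)"
      using finite_V vV that Ax unfolding W_def by (intro sum.mono_neutral_right) auto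
    then show ?thesis unfolding \<tau>_def by simp
  qed
  \<comment> \<open>\<open>A x\<close> is not controlled outside \<open>U\<close>, but rows of
    \<open>M\<close> in \<open>U\<close> vanish there, and rows outside \<open>U\<close> are removed
    by \<open>x i = 0\<close>. Rows in \<open>W\<close> vanish at the sink \<open>v\<close>, so only
    row \<open>v\<close> contributes.\<close>
  have MA: "x i * (\<Sum>k\<in>V. M i k * A x k) = (if i = v then M v v * \<tau> else 0)" if "i \<in> V" for i
  proof (cases "i \<in> U")
    case True
    have "(\<Sum>k\<in>V. M i k * A x k) = M i v * \<tau>"
    proof -
      have "(\<Sum>k\<in>V. M i k * A x k) = (\<Sum>k\<in>{v}. M i k * A x k)"
        using finite_V vV Suc.prems(2)[OF True] Ax unfolding W_def
        by (intro sum.mono_neutral_right) auto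
      then show ?thesis unfolding \<tau>_def by simp
    qed
    then show ?thesis using sink[of i] xv True unfolding W_def by auto
  next
    case False
    then show ?thesis using xU v by auto
  qed
  have quad: "(\<Sum>i\<in>V. x i * (\<Sum>k\<in>V. M i k * A x k)) = M v v * \<tau>"
    using MA finite_V vV by simp
  \<comment> \<open>The equation is contracted with \<open>x\<close> on both sides. By symmetry of
    \<open>S\<close> the two products contribute equally.\<close>
  have "(\<Sum>i\<in>V. \<Sum>j\<in>V. x i * x j * ((\<Sum>k\<in>V. M i k * S k j) + (\<Sum>k\<in>V. S i k * M j k) + C i j)) = 0"
    using lyap unfolding lyapunov_on_def by simp
  moreover have "(\<Sum>i\<in>V. \<Sum>j\<in>V. x i * x j * (\<Sum>k\<in>V. M i k * S k j)) = M v v * \<tau>"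
  proof -
    have "(\<Sum>j\<in>V. x i * x j * (\<Sum>k\<in>V. M i k * S k j)) = x i * (\<Sum>k\<in>V. M i k * A x k)" for i
      unfolding A_def sum_distrib_left by (subst sum.swap) (simp add: mult_ac)
    then show ?thesis using quad by simp
  qed
  moreover have "(\<Sum>i\<in>V. \<Sum>j\<in>V. x i * x j * (\<Sum>k\<in>V. S i k * M j k)) = M v v * \<tau>"
  proof -
    have "(\<Sum>i\<in>V. x i * x j * (\<Sum>k\<in>V. S i k * M j k)) = x j * (\<Sum>k\<in>V. M j k * A x k)" for j
    proof -
      have "(\<Sum>i\<in>V. x i * x j * (\<Sum>k\<in>V. S i k * M j k)) =
            (\<Sum>k\<in>V. \<Sum>i\<in>V. x i * x j * (S i k * M j k))"
        unfolding sum_distrib_left by (rule sum.swap)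
      also have "\<dots> = (\<Sum>k\<in>V. \<Sum>i\<in>V. x j * (M j k * (S k i * x i)))"
        using sym by (intro sum.cong) (auto simp: mult_ac)
      finally show ?thesis unfolding A_def sum_distrib_left .
    qed
    then show ?thesis using quad by (subst sum.swap) simp
  qed
  moreover have "(\<Sum>i\<in>V. \<Sum>j\<in>V. x i * x j * C i j) > 0"
  proof -
    have "0 < (\<Sum>i\<in>V. x i * (\<Sum>j\<in>V. C i j * x j))"
      using C[unfolded pos_def_on_def, rule_format, of x] xv vV by fastforce
    then show ?thesis by (simp add: sum_distrib_left mult_ac)
  qed
  ultimately have "2 * (M v v * \<tau>) < 0"
    by (simp add: distrib_left sum.distrib)
  then have \<tau>: "\<tau> > 0" using neg[OF vV] by (auto simp: mult_less_0_iff)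
  show ?case
  proof (intro conjI allI impI)
    fix s
    obtain y where y: "\<And>i. i \<notin> W \<Longrightarrow> y i = 0" "\<And>i. i \<in> W \<Longrightarrow> A y i = s i"
      using IH[of s] unfolding A_def by blast
    \<comment> \<open>Adding a multiple of \<open>x\<close> repairs the equation at \<open>v\<close>
      without disturbing those on \<open>W\<close>.\<close>
    define z where "z j = y j + ((s v - A y v) / \<tau>) * x j" for j
    have Az: "A z i = A y i + ((s v - A y v) / \<tau>) * A x i" for i
      using A_add[of y "(s v - A y v) / \<tau>" x i] unfolding z_def .
    have "A z i = s i" if "i \<in> U" for i
    proof (cases "i = v")
      case True
      then show ?thesis using Az[of v] \<tau> \<tau>_def by simp
    next
      case False
      then have "i \<in> W" using that W_def by auto
      then show ?thesis using Az[of i] y(2) Ax by simp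
    qed
    moreover have "z i = 0" if "i \<notin> U" for i
      using that y(1)[of i] xU[of i] unfolding z_def W_def by simp
    ultimately show "\<exists>y. (\<forall>i. i \<notin> U \<longrightarrow> y i = 0) \<and> (\<forall>i\<in>U. (\<Sum>j\<in>V. S i j * y j) = s i)"
      unfolding A_def by blast
  next
    fix y :: "'a \<Rightarrow> real"
    assume y: "\<forall>i. i \<notin> U \<longrightarrow> y i = 0" and ne: "\<exists>i. y i \<noteq> 0"
    \<comment> \<open>Completing the square: \<open>u\<close> is supported on \<open>W\<close> and
      orthogonal to \<open>x\<close> under \<open>S\<close>, so the form of \<open>y\<close> splits
      into that of \<open>u\<close> and \<open>\<tau>\<close> times the square of
      \<open>y v\<close>.\<close>
    define u where "u j = y j + (- y v) * x j" for j
    have uW: "\<forall>i. i \<notin> W \<longrightarrow> u i = 0"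
      using y xU xv unfolding u_def W_def by auto
    then have uv: "u v = 0" unfolding W_def by auto
    have uU: "u i = 0" if "i \<notin> U" for i using uW that unfolding W_def by auto
    have y_eq: "y = (\<lambda>j. u j + y v * x j)" unfolding u_def by simp
    have Ay: "A y i = A u i + y v * A x i" for i
      using A_add[of u "y v" x i] y_eq by simp
    have xAu: "(\<Sum>i\<in>V. x i * A u i) = 0"
      using A_self_adjoint[of x u] xA[of u] uU uv by simp
    have "(\<Sum>i\<in>V. y i * A y i) = (\<Sum>i\<in>V. y i * A u i) + y v * (\<Sum>i\<in>V. y i * A x i)"
      unfolding Ay by (simp add: sum.distrib sum_distrib_left algebra_simps)
    also have "(\<Sum>i\<in>V. y i * A x i) = y v * \<tau>" using xA y by blast
    also have "(\<Sum>i\<in>V. y i * A u i) = (\<Sum>i\<in>V. u i * A u i) + y v * (\<Sum>i\<in>V. x i * A u i)"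
    proof -
      have "y i * A u i = u i * A u i + y v * (x i * A u i)" for i
        unfolding u_def by (simp add: algebra_simps)
      then show ?thesis by (simp add: sum.distrib sum_distrib_left)
    qed
    finally have expand: "(\<Sum>i\<in>V. y i * A y i) = (\<Sum>i\<in>V. u i * A u i) + (y v)\<^sup>2 * \<tau>"
      using xAu by (simp add: power2_eq_square)
    have "0 < (\<Sum>i\<in>V. y i * A y i)"
    proof (cases "\<exists>i. u i \<noteq> 0")
      case True
      then have "0 < (\<Sum>i\<in>V. u i * A u i)" using posW[OF uW] unfolding A_def by blast
      then show ?thesis using expand \<tau> by (simp add: add_pos_nonneg)
    next
      case False
      then have "y v \<noteq> 0" using ne y_eq by (metis add_0 mult_zero_left)
      moreover have "(\<Sum>i\<in>V. u i * A u i) = 0" using False by simp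
      ultimately show ?thesis using expand \<tau> by simp
    qed
    then show "0 < (\<Sum>i\<in>V. y i * (\<Sum>j\<in>V. S i j * y j))" unfolding A_def .
  qed
qed

lemma lyapunov_solution_pos_def:
  assumes "\<And>i. i \<in> V \<Longrightarrow> M i i < 0" and "pos_def_on V C"
    and "\<And>i j. \<lbrakk>i \<in> V; j \<in> V\<rbrakk> \<Longrightarrow> S i j = S j i" and "lyapunov_on V M S C"
  shows "pos_def_on V S"
  unfolding pos_def_on_def
proof (intro allI impI)
  fix x :: "'a \<Rightarrow> real" assume ne: "\<exists>i\<in>V. x i \<noteq> 0"
  define y where "y i = (if i \<in> V then x i else 0)" for i
  have "\<exists>i. y i \<noteq> 0" using ne unfolding y_def by auto
  then have "0 < (\<Sum>i\<in>V. y i * (\<Sum>j\<in>V. S i j * y j))"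
    using lyapunov_solution_pos_def_aux[OF assms, of V, THEN conjunct2, rule_format, of y]
    by (simp add: y_def)
  then show "0 < (\<Sum>i\<in>V. x i * (\<Sum>j\<in>V. S i j * x j))"
    unfolding y_def by simp
qed

end

section \<open>Topological rankings and the diagonal of a triangular matrix\<close>

lemma finite_acyclic_rank:
  assumes "finite R" and "acyclic R"
  obtains f :: "'a \<Rightarrow> nat" where "\<And>i j. (i, j) \<in> R \<Longrightarrow> f i < f j"
proof
  \<comment> \<open>The rank is the number of strict ancestors. Along an edge the ancestors of
    \<open>i\<close> stay ancestors of \<open>j\<close>, and \<open>i\<close> itself is a new one by
    acyclicity.\<close>
  fix i j assume ij: "(i, j) \<in> R"
  have "finite {k. (k, j) \<in> R\<^sup>+}"
    using assms(1) finite_subset[of "{k. (k, j) \<in> R\<^sup>+}" "fst ` R\<^sup>+"] by force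
  moreover have "{k. (k, i) \<in> R\<^sup>+} \<subset> {k. (k, j) \<in> R\<^sup>+}"
    using ij assms(2) unfolding acyclic_def by (auto intro: trancl_into_trancl)
  ultimately show "card {k. (k, i) \<in> R\<^sup>+} < card {k. (k, j) \<in> R\<^sup>+}"
    by (rule psubset_card_mono)
qed

text \<open>In the Leibniz expansion of the characteristic matrix, a nonzero term comes from a
  permutation that lowers the rank at every moved index. It must move \<open>l\<close>, where the
  diagonal entry is zero, so the sum of all ranks would drop, yet a permutation preserves that
  sum.\<close>

lemma eigenvalue_diagonal_triangular:
  fixes A :: "'a :: field mat"
  assumes A: "A \<in> carrier_mat n n" and l: "l < n"
    and rank: "\<And>i j. \<lbrakk>i < n; j < n; i \<noteq> j; A $$ (i, j) \<noteq> 0\<rbrakk> \<Longrightarrow> f j < (f i :: nat)"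
  shows "eigenvalue A (A $$ (l, l))"
proof -
  let ?B = "char_matrix A (A $$ (l, l))"
  have B: "?B \<in> carrier_mat n n" using A by (simp add: char_matrix_def)
  have zero: "(\<Prod>i = 0..<n. ?B $$ (i, \<pi> i)) = 0" if \<pi>: "\<pi> permutes {0..<n}" for \<pi>
  proof -
    have "\<exists>k<n. ?B $$ (k, \<pi> k) = 0"
    proof (rule ccontr)
      assume "\<not> ?thesis"
      then have nz: "\<And>k. k < n \<Longrightarrow> ?B $$ (k, \<pi> k) \<noteq> 0" by auto
      have \<pi>n: "\<pi> k < n" if "k < n" for k using permutes_in_image[OF \<pi>, of k] that by simp
      have lt: "f (\<pi> k) < f k" if "k < n" "\<pi> k \<noteq> k" for k
        using nz[OF that(1)] rank[of k "\<pi> k"] that \<pi>n[OF that(1)] A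
        by (auto simp: char_matrix_def)
      have "\<pi> l \<noteq> l" using nz[OF l] l A by (auto simp: char_matrix_def)
      then have "(\<Sum>k = 0..<n. f (\<pi> k)) < (\<Sum>k = 0..<n. f k)"
      proof (intro sum_strict_mono_ex1 ballI)
        show "f (\<pi> k) \<le> f k" if "k \<in> {0..<n}" for k
          using lt[of k] that by (cases "\<pi> k = k") auto
      qed (use lt[OF l] l in auto)
      moreover have "(\<Sum>k = 0..<n. f (\<pi> k)) = (\<Sum>k = 0..<n. f k)"
        using sum.permute[OF \<pi>, of f] by (simp add: comp_def)
      ultimately show False by simp
    qed
    then show ?thesis by auto
  qed
  have "det ?B = 0"
    unfolding det_def'[OF B] using zero by (intro sum.neutral) auto
  then show ?thesis using eigenvalue_det[OF A] by simp
qed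

section \<open>Transfer to matrices and global identifiability\<close>

lemma PD_iff:
  assumes "S \<in> carrier_mat p p"
  shows "S \<in> PD p \<longleftrightarrow> (\<forall>i<p. \<forall>j<p. S $$ (i, j) = S $$ (j, i)) \<and>
    pos_def_on {..<p} (\<lambda>i j. S $$ (i, j))"
proof -
  have quad: "x \<bullet> (S *\<^sub>v x) = (\<Sum>i<p. x $ i * (\<Sum>j<p. S $$ (i, j) * x $ j))"
    if "x \<in> carrier_vec p" for x
    using that assms by (simp add: scalar_prod_def lessThan_atLeast0)
  have nonzero: "x \<noteq> 0\<^sub>v p \<longleftrightarrow> (\<exists>i\<in>{..<p}. x $ i \<noteq> 0)" if "x \<in> carrier_vec p" for x :: "real vec"
    using that by (auto intro!: eq_vecI)
  have "(\<forall>x \<in> carrier_vec p. x \<noteq> 0\<^sub>v p \<longrightarrow> x \<bullet> (S *\<^sub>v x) > 0) \<longleftrightarrow>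
    pos_def_on {..<p} (\<lambda>i j. S $$ (i, j))" (is "?L \<longleftrightarrow> ?R")
  proof
    assume L: ?L
    show ?R
      unfolding pos_def_on_def
    proof (intro allI impI)
      fix x :: "nat \<Rightarrow> real" assume ne: "\<exists>i\<in>{..<p}. x i \<noteq> 0"
      have c: "vec p x \<in> carrier_vec p" by simp
      have "vec p x \<noteq> 0\<^sub>v p" using nonzero[OF c] ne by auto
      then show "0 < (\<Sum>i<p. x i * (\<Sum>j<p. S $$ (i, j) * x j))"
        using L[rule_format, OF c] unfolding quad[OF c] by simp
    qed
  next
    assume ?R
    then show ?L unfolding pos_def_on_def using quad nonzero by simp
  qed
  moreover have "transpose_mat S = S \<longleftrightarrow> (\<forall>i<p. \<forall>j<p. S $$ (i, j) = S $$ (j, i))"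
    using assms by (auto simp: mat_eq_iff)
  ultimately show ?thesis using assms unfolding PD_def by auto
qed

lemma lyapunov_equation_iff:
  assumes "M \<in> carrier_mat p p" "S \<in> carrier_mat p p" "C \<in> carrier_mat p p"
  shows "M * S + S * transpose_mat M + C = 0\<^sub>m p p \<longleftrightarrow>
    lyapunov_on {..<p} (\<lambda>i j. M $$ (i, j)) (\<lambda>i j. S $$ (i, j)) (\<lambda>i j. C $$ (i, j))"
  using assms unfolding lyapunov_on_def
  by (auto simp: mat_eq_iff scalar_prod_def lessThan_atLeast0)

text \<open>Justifies the definite description in \<open>lyapunov_solution\<close>. For uniqueness,
  the difference of two solutions solves the homogeneous equation.\<close>

lemma lyapunov_solution_unique_PD:
  assumes C: "C \<in> PD p" and M: "M \<in> carrier_mat p p"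
    and acyc: "acyclic_matrix {..<p} f (\<lambda>i j. M $$ (i, j))"
    and neg: "\<And>i. i < p \<Longrightarrow> M $$ (i, i) < 0"
  shows "\<exists>!S. S \<in> PD p \<and> M * S + S * transpose_mat M + C = 0\<^sub>m p p"
proof -
  interpret acyclic_matrix "{..<p}" f "\<lambda>i j. M $$ (i, j)" by fact
  have neg': "\<And>i. i \<in> {..<p} \<Longrightarrow> M $$ (i, i) < 0" using neg by simp
  have Cc: "C \<in> carrier_mat p p" using C unfolding PD_def by simp
  let ?C = "\<lambda>i j. C $$ (i, j)"
  have Csym: "\<And>i j. \<lbrakk>i \<in> {..<p}; j \<in> {..<p}\<rbrakk> \<Longrightarrow> ?C i j = ?C j i"
    and Cpos: "pos_def_on {..<p} ?C" using C unfolding PD_iff[OF Cc] by simp_all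
  define S where "S = mat p p (\<lambda>(i, j). triangular_solution ?C i j)"
  have Sc: "S \<in> carrier_mat p p" unfolding S_def by simp
  have lyap: "lyapunov_on {..<p} (\<lambda>i j. M $$ (i, j)) (\<lambda>i j. S $$ (i, j)) ?C"
    using lyapunov_triangular_solution[OF neg', of ?C] unfolding lyapunov_on_def S_def by simp
  have Ssym: "\<And>i j. \<lbrakk>i \<in> {..<p}; j \<in> {..<p}\<rbrakk> \<Longrightarrow> S $$ (i, j) = S $$ (j, i)"
    using triangular_solution_symmetric[of ?C] Csym unfolding S_def by simp
  have "S \<in> PD p"
    using lyapunov_solution_pos_def[OF neg' Cpos Ssym lyap] Ssym unfolding PD_iff[OF Sc] by simp
  moreover have "M * S + S * transpose_mat M + C = 0\<^sub>m p p"
    using lyap lyapunov_equation_iff[OF M Sc Cc] by simp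
  moreover have "T = S" if T: "T \<in> PD p \<and> M * T + T * transpose_mat M + C = 0\<^sub>m p p" for T
  proof -
    have Tc: "T \<in> carrier_mat p p" using T unfolding PD_def by simp
    have lyapT: "lyapunov_on {..<p} (\<lambda>i j. M $$ (i, j)) (\<lambda>i j. T $$ (i, j)) ?C"
      using T lyapunov_equation_iff[OF M Tc Cc] by simp
    have "lyapunov_on {..<p} (\<lambda>i j. M $$ (i, j)) (\<lambda>i j. T $$ (i, j) - S $$ (i, j)) (\<lambda>_ _. 0)"
      unfolding lyapunov_on_def
    proof (intro ballI)
      fix i j assume ij: "i \<in> {..<p}" "j \<in> {..<p}"
      show "(\<Sum>k<p. M $$ (i, k) * (T $$ (k, j) - S $$ (k, j))) +
            (\<Sum>k<p. (T $$ (i, k) - S $$ (i, k)) * M $$ (j, k)) + 0 = 0"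
        using lyap[unfolded lyapunov_on_def, rule_format, OF ij]
          lyapT[unfolded lyapunov_on_def, rule_format, OF ij]
        by (simp add: left_diff_distrib right_diff_distrib sum_subtractf)
    qed
    then show ?thesis
      using lyapunov_homogeneous_zero[OF neg', of "\<lambda>i j. T $$ (i, j) - S $$ (i, j)"] Sc Tc
      by (intro eq_matI) auto
  qed
  ultimately show ?thesis by blast
qed

theorem theorem23:
  fixes p :: nat and E :: "(nat \<times> nat) set"
  assumes "dag_with_self_loops p E"
  shows "\<forall>C \<in> PD p. globally_identifiable p E C"
proof
  fix C assume C: "C \<in> PD p"
  have Cc: "C \<in> carrier_mat p p" using C unfolding PD_def by simp
  have "E \<subseteq> {..<p} \<times> {..<p}" and acyc: "acyclic (E - Id)"
    using assms unfolding dag_with_self_loops_def by auto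
  then have "finite (E - Id)" using finite_subset by (metis finite_Diff finite_SigmaI finite_lessThan)
  then obtain f :: "nat \<Rightarrow> nat" where f: "\<And>i j. (i, j) \<in> E - Id \<Longrightarrow> f i < f j"
    using finite_acyclic_rank acyc by blast
  \<comment> \<open>The ranking depends on \<open>E\<close> alone, so it serves every edge matrix at
    once.\<close>
  have am: "acyclic_matrix {..<p} f (\<lambda>i j. M $$ (i, j))" if "M \<in> edge_matrices p E" for M
    using that f unfolding edge_matrices_def by unfold_locales auto
  have sol: "lyapunov_solution p C M \<in> PD p \<and>
      M * lyapunov_solution p C M + lyapunov_solution p C M * transpose_mat M + C = 0\<^sub>m p p"
    if M: "M \<in> Stab p E" for M
  proof -
    have Me: "M \<in> edge_matrices p E" and Mc: "M \<in> carrier_mat p p" and st: "stable_mat M"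
      using M unfolding Stab_def edge_matrices_def by auto
    interpret acyclic_matrix "{..<p}" f "\<lambda>i j. M $$ (i, j)" using am[OF Me] .
    have "M $$ (i, i) < 0" if "i < p" for i
    proof -
      \<comment> \<open>Stability speaks of complex eigenvalues, so the triangular criterion is
        applied to the complexified matrix, whose diagonal is still real.\<close>
      have "eigenvalue (map_mat complex_of_real M) (map_mat complex_of_real M $$ (i, i))"
        using Mc that rank_less by (intro eigenvalue_diagonal_triangular[of _ p _ f]) auto
      then show ?thesis using st that Mc unfolding stable_mat_def by fastforce
    qed
    then show ?thesis
      using theI'[OF lyapunov_solution_unique_PD[OF C Mc am[OF Me]]]
      unfolding lyapunov_solution_def by blast
  qed
  show "globally_identifiable p E C"
    unfolding globally_identifiable_def
  proof (intro ballI equalityI subsetI)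
    fix M0 M assume M0: "M0 \<in> Stab p E" and "M \<in> lyapunov_fiber p E C M0"
    then have M: "M \<in> Stab p E" and eq: "lyapunov_solution p C M = lyapunov_solution p C M0"
      unfolding lyapunov_fiber_def by auto
    define S where "S = lyapunov_solution p C M0"
    have S: "S \<in> PD p" and Sc: "S \<in> carrier_mat p p"
      using sol[OF M0] unfolding S_def PD_def by auto
    have Mc: "M \<in> carrier_mat p p" "M0 \<in> carrier_mat p p"
      using M M0 unfolding Stab_def edge_matrices_def by auto
    have lyap: "lyapunov_on {..<p} (\<lambda>i j. M $$ (i, j)) (\<lambda>i j. S $$ (i, j)) (\<lambda>i j. C $$ (i, j))"
      "lyapunov_on {..<p} (\<lambda>i j. M0 $$ (i, j)) (\<lambda>i j. S $$ (i, j)) (\<lambda>i j. C $$ (i, j))"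
      using sol[OF M] sol[OF M0] lyapunov_equation_iff[OF _ Sc Cc] Mc eq S_def by auto
    \<comment> \<open>The zero pattern is linear and passes to the difference, and with it the
      triangularity; subtracting the two equations for the common \<open>S\<close> cancels
      \<open>C\<close>.\<close>
    have "M - M0 \<in> edge_matrices p E"
      using M M0 unfolding Stab_def edge_matrices_def by auto
    then interpret acyclic_matrix "{..<p}" f "\<lambda>i j. (M - M0) $$ (i, j)" by (rule am)
    have "lyapunov_on {..<p} (\<lambda>i j. (M - M0) $$ (i, j)) (\<lambda>i j. S $$ (i, j)) (\<lambda>_ _. 0)"
      unfolding lyapunov_on_def
    proof (intro ballI)
      fix i j assume ij: "i \<in> {..<p}" "j \<in> {..<p}"
      show "(\<Sum>k<p. (M - M0) $$ (i, k) * S $$ (k, j)) +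
            (\<Sum>k<p. S $$ (i, k) * (M - M0) $$ (j, k)) + 0 = 0"
        using lyap(1)[unfolded lyapunov_on_def, rule_format, OF ij]
          lyap(2)[unfolded lyapunov_on_def, rule_format, OF ij] ij Mc
        by (simp add: left_diff_distrib right_diff_distrib sum_subtractf)
    qed
    then have "(M - M0) $$ (i, j) = 0" if "i < p" "j < p" for i j
      using skew_product_imp_zero[of "\<lambda>i j. S $$ (i, j)" i j] S that
      unfolding PD_iff[OF Sc] by simp
    then have "M = M0" using Mc by (intro eq_matI) auto
    then show "M \<in> {M0}" by simp
  next
    fix M0 M assume "M0 \<in> Stab p E" and "M \<in> {M0}"
    then show "M \<in> lyapunov_fiber p E C M0" unfolding lyapunov_fiber_def by simp
  qed
qed

end
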